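(* Let $(G,\prec)$ be a Nyldon-like set over $A$. Then (1) every primitive word $w\in A^+$ has exactly one conjugate that lies in $G$; and (2) no nonempty non-primitive word lies in $G$.
   Context: $A$ is a finite alphabet with at least two letters. For $w\in A^+$, a $G$-factorization of $w$ is a sequence $(w_1,\dots,w_k)$, $k\ge 1$, of words of $G$ with $w=w_1w_2\cdots w_k$ and $w_1\preceq w_2\preceq\cdots\preceq w_k$. A Nyldon-like set is a pair $(G,\prec)$ with $G\subseteq A^+$ and $\prec$ a total order on $G$ such that: every letter of $A$ lies in $G$; a word $w$ of length at least $2$ lies in $G$ if and only if $w$ has no $G$-factorization with $k\ge 2$ factors; and for all $f,g\in G$ with $fg\in G$ we have $f\prec fg$. A word is primitive if it is not $u^k$ for any word $u$ and $k\ge 2$; $x$ is a conjugate of $w$ if $w=uv$ and $x=vu$ for some words $u,v$. *)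

theory Defs
  imports Main
begin

text \<open>
  Words over an alphabet \<open>A\<close> are the elements of \<^term>\<open>lists A\<close>.  The strict order of a
  Nyldon-like set is a relation \<open>prec\<close> on all words of which only the restriction to \<open>G\<close>
  is ever used; the associated weak order is its reflexive closure.
\<close>

definition word_factorization ::
  "'a list set \<Rightarrow> ('a list \<Rightarrow> 'a list \<Rightarrow> bool) \<Rightarrow> 'a list \<Rightarrow> 'a list list \<Rightarrow> bool" where
  "word_factorization G prec w ws \<longleftrightarrow>
     length ws \<ge> 1 \<and> set ws \<subseteq> G \<and> w = concat ws \<and> successively (prec\<^sup>=\<^sup>=) ws"

definition strict_total_order_on ::
  "'b set \<Rightarrow> ('b \<Rightarrow> 'b \<Rightarrow> bool) \<Rightarrow> bool" where
  "strict_total_order_on S prec \<longleftrightarrow> irreflp_on S prec \<and> transp_on S prec \<and> totalp_on S prec"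

definition nyldon_like ::
  "'a set \<Rightarrow> 'a list set \<Rightarrow> ('a list \<Rightarrow> 'a list \<Rightarrow> bool) \<Rightarrow> bool" where
  "nyldon_like A G prec \<longleftrightarrow>
     G \<subseteq> lists A - {[]} \<and>
     strict_total_order_on G prec \<and>
     (\<forall>a\<in>A. [a] \<in> G) \<and>
     (\<forall>w\<in>lists A. length w \<ge> 2 \<longrightarrow>
        (w \<in> G \<longleftrightarrow> \<not> (\<exists>ws. word_factorization G prec w ws \<and> length ws \<ge> 2))) \<and>
     (\<forall>f\<in>G. \<forall>g\<in>G. f @ g \<in> G \<longrightarrow> prec f (f @ g))"

definition primitive_word :: "'a list \<Rightarrow> bool" where
  "primitive_word w \<longleftrightarrow> \<not> (\<exists>u k. k \<ge> 2 \<and> w = concat (replicate k u))"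

definition conjugate_of :: "'a list \<Rightarrow> 'a list \<Rightarrow> bool" where
  "conjugate_of x w \<longleftrightarrow> (\<exists>u v. w = u @ v \<and> x = v @ u)"

end

theory Submission
  imports Defs
begin

text \<open>
  A proper suffix in \<open>G\<close> of an element of \<open>G\<close> is smaller than that element; hence the last factor
  of a factorization is the longest suffix in \<open>G\<close>, and factorizations are unique.  It follows that
  for every up-set \<open>U\<close> of \<open>G\<close> the words all of whose factors lie in \<open>U\<close> form a submonoid.

  Let \<open>u\<close>, \<open>v\<close> be nonempty and let \<open>m\<close> be the smallest factor of \<open>u\<close> and \<open>v\<close>, say the first factor
  of \<open>u\<close>.  Then \<open>u @ v\<close> is \<open>m\<close> followed by a product of elements \<open>\<ge> m\<close>, so it is not in \<open>G\<close>.  Thus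
  \<open>u @ v\<close> and \<open>v @ u\<close> are never both in \<open>G\<close>, which gives uniqueness and excludes proper powers.

  For existence, choose the conjugate whose first factor \<open>m\<close> is as large as possible and write it as
  \<open>m\<^sup>j @ f\<close> with all factors of \<open>f\<close> above \<open>m\<close>.  If \<open>f\<close> were nonempty, all factors of \<open>f @ m\<^sup>j\<close> would
  be above \<open>m\<close>, against maximality; so the conjugate is \<open>m\<^sup>j\<close>, and \<open>j = 1\<close> by primitivity.
\<close>

section \<open>Cutting words, conjugation and primitivity\<close>

lemma append_eq_append_cases:
  assumes "a @ b = c @ d"
  obtains (prefix) t where "c = a @ t" "b = t @ d" | (longer) t where "a = c @ t" "d = t @ b" "t \<noteq> []"
proof -
  obtain t where "a = c @ t \<and> t @ b = d \<or> a @ t = c \<and> b = t @ d"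
    using iffD1[OF append_eq_append_conv2 assms] by blast
  then show thesis using that by (cases "t = []") auto
qed

text \<open>The cut after \<open>p\<close> is located in a factor \<open>r\<close>. A cut between
  two factors counts as the start of a later one; this is why \<open>y\<close> is nonempty while
  \<open>x\<close> may be empty.\<close>

lemma concat_eq_append_split:
  assumes "concat rs = p @ s" "s \<noteq> []"
  obtains as r bs x y where "rs = as @ r # bs" "p = concat as @ x" "r = x @ y" "y \<noteq> []"
    "s = y @ concat bs"
  using assms
proof (induction rs arbitrary: p thesis)
  case Nil
  then show ?case by simp
next
  case (Cons r rs)
  from Cons.prems(2) have "r @ concat rs = p @ s" by simp
  then consider t where "r = p @ t" "t \<noteq> []" "s = t @ concat rs"
    | t where "p = r @ t" "concat rs = t @ s"
    by (rule append_eq_append_cases) auto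
  then show ?case
  proof cases
    case 1
    then show ?thesis using Cons.prems(1)[of "[]" r rs p t] by simp
  next
    case 2
    obtain as r' bs x y where "rs = as @ r' # bs" "t = concat as @ x" "r' = x @ y" "y \<noteq> []"
      "s = y @ concat bs"
      using Cons.IH[OF _ 2(2) Cons.prems(3)] by blast
    then show ?thesis using Cons.prems(1)[of "r # as" r' bs x y] 2 by simp
  qed
qed

text \<open>Rotations compose by adding their amounts, which gives transitivity of conjugation
  without comparing cut points.\<close>

lemma conjugate_of_iff_rotate: "conjugate_of x w \<longleftrightarrow> (\<exists>n. x = rotate n w)"
proof
  assume "conjugate_of x w"
  then obtain u v where "w = u @ v" "x = v @ u" by (auto simp: conjugate_of_def)
  then show "\<exists>n. x = rotate n w" by (metis rotate_append)
next
  assume "\<exists>n. x = rotate n w"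
  then show "conjugate_of x w"
    by (metis conjugate_of_def append_take_drop_id rotate_drop_take)
qed

lemma conjugate_of_trans: "conjugate_of x y \<Longrightarrow> conjugate_of y z \<Longrightarrow> conjugate_of x z"
  unfolding conjugate_of_iff_rotate by (metis rotate_rotate)

lemma conjugate_of_sym: "conjugate_of x y \<Longrightarrow> conjugate_of y x"
  by (auto simp: conjugate_of_def)

lemma conjugate_of_refl: "conjugate_of x x"
  unfolding conjugate_of_def by (metis append_Nil append_Nil2)

lemma rotate1_concat_replicate:
  "rotate1 (concat (replicate k u)) = concat (replicate k (rotate1 u))"
proof (cases u)
  case Nil
  then show ?thesis by (induction k) auto
next
  case (Cons c u')
  \<comment> \<open>Moving the leading letter of a power of \<open>c # u'\<close> to the end only
    shifts the brackets: each \<open>c\<close> now closes the block before it.\<close>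
  have "u' @ concat (replicate n (c # u')) @ [c] = concat (replicate (Suc n) (u' @ [c]))" for n
    by (induction n) simp_all
  then show ?thesis using Cons by (cases k) simp_all
qed

lemma rotate_concat_replicate:
  "rotate n (concat (replicate k u)) = concat (replicate k (rotate n u))"
  by (induction n) (simp_all add: rotate1_concat_replicate)

text \<open>A rotation of a power is the power, with the same exponent, of the rotated root; so if
  \<open>x\<close> were a proper power, \<open>w\<close> would be one too.\<close>

lemma primitive_word_conjugate:
  assumes "primitive_word w" "conjugate_of x w"
  shows "primitive_word x"
proof -
  obtain n where n: "w = rotate n x"
    using conjugate_of_sym[OF assms(2)] by (auto simp: conjugate_of_iff_rotate)
  have "\<exists>u. w = concat (replicate k u)" if "x = concat (replicate k u)" for k u
    using n that rotate_concat_replicate by metis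
  then show ?thesis using assms(1) unfolding primitive_word_def by blast
qed

section \<open>Factorizations over a Nyldon-like set\<close>

locale nyldon =
  fixes A :: "'a set" and G :: "'a list set" and prec :: "'a list \<Rightarrow> 'a list \<Rightarrow> bool"
  assumes nyldon_like: "nyldon_like A G prec"
begin

text \<open>Unlike \<open>word_factorization\<close>, this admits the empty list, so the empty word
  has a factorization too. It compares all pairs instead of neighbours, so that factorizations can
  be cut and glued; by transitivity on \<open>G\<close> the two orderings agree.\<close>

definition factored :: "'a list list \<Rightarrow> bool" where
  "factored ws \<longleftrightarrow> set ws \<subseteq> G \<and> sorted_wrt (prec\<^sup>=\<^sup>=) ws"

lemma G_lists: "w \<in> G \<Longrightarrow> w \<in> lists A" and G_nonempty: "w \<in> G \<Longrightarrow> w \<noteq> []"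
  using nyldon_like by (auto simp: nyldon_like_def)

lemma Nil_notin_G [simp]: "[] \<notin> G"
  using G_nonempty by blast

lemma letter_in_G: "a \<in> A \<Longrightarrow> [a] \<in> G"
  using nyldon_like by (auto simp: nyldon_like_def)

lemma prec_append: "f \<in> G \<Longrightarrow> g \<in> G \<Longrightarrow> f @ g \<in> G \<Longrightarrow> prec f (f @ g)"
  using nyldon_like by (auto simp: nyldon_like_def)

lemma prec_irrefl: "x \<in> G \<Longrightarrow> \<not> prec x x"
  using nyldon_like by (auto simp: nyldon_like_def strict_total_order_on_def irreflp_on_def)

lemma prec_trans: "prec x y \<Longrightarrow> prec y z \<Longrightarrow> x \<in> G \<Longrightarrow> y \<in> G \<Longrightarrow> z \<in> G \<Longrightarrow> prec x z"
  using nyldon_like unfolding nyldon_like_def strict_total_order_on_def transp_on_def by blast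

lemma prec_total: "x \<in> G \<Longrightarrow> y \<in> G \<Longrightarrow> prec x y \<or> x = y \<or> prec y x"
  using nyldon_like unfolding nyldon_like_def strict_total_order_on_def totalp_on_def by blast

lemma successively_iff_sorted_wrt:
  assumes "set ws \<subseteq> G"
  shows "successively (prec\<^sup>=\<^sup>=) ws \<longleftrightarrow> sorted_wrt (prec\<^sup>=\<^sup>=) ws"
proof (rule successively_iff_sorted_wrt_strong)
  fix x y z assume "x \<in> set ws" "y \<in> set ws" "z \<in> set ws" "prec\<^sup>=\<^sup>= x y" "prec\<^sup>=\<^sup>= y z"
  with assms prec_trans show "prec\<^sup>=\<^sup>= x z" by blast
qed

lemma not_in_G_iff:
  assumes "w \<in> lists A" "length w \<ge> 2"
  shows "w \<notin> G \<longleftrightarrow> (\<exists>ws. factored ws \<and> concat ws = w \<and> length ws \<ge> 2)"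
proof -
  have "w \<notin> G \<longleftrightarrow> (\<exists>ws. word_factorization G prec w ws \<and> length ws \<ge> 2)"
    using nyldon_like assms unfolding nyldon_like_def by blast
  also have "\<dots> \<longleftrightarrow> (\<exists>ws. factored ws \<and> concat ws = w \<and> length ws \<ge> 2)"
    unfolding word_factorization_def factored_def using successively_iff_sorted_wrt
    by (metis (no_types, lifting) le_trans one_le_numeral)
  finally show ?thesis .
qed

lemma length_concat_ge: "set ws \<subseteq> G \<Longrightarrow> length ws \<le> length (concat ws)"
proof (induction ws)
  case (Cons w ws)
  then have "length w \<ge> 1" by (cases w) auto
  with Cons show ?case by simp
qed simp

lemma factored_concat_lists: "factored ws \<Longrightarrow> concat ws \<in> lists A"
  using G_lists by (induction ws) (auto simp: factored_def)

text \<open>Two or more nonempty factors give a word of length at least 2, and then the defining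
  condition forbids such a factorization of an element of \<open>G\<close>.\<close>

lemma factored_concat_in_G:
  assumes "factored ws" "concat ws \<in> G"
  shows "ws = [concat ws]"
proof -
  have "\<not> length ws \<ge> 2"
    using not_in_G_iff[of "concat ws"] assms G_lists length_concat_ge[of ws]
    by (auto simp: factored_def)
  with assms(2) show ?thesis by (cases ws rule: remdups_adj.cases) auto
qed

lemma factored_exists:
  assumes "w \<in> lists A"
  shows "\<exists>ws. factored ws \<and> concat ws = w"
proof (cases "w \<in> G")
  case True
  then have "factored [w] \<and> concat [w] = w" by (simp add: factored_def)
  then show ?thesis by blast
next
  case False
  show ?thesis
  \<comment> \<open>Lengths 0, 1 and at least 2 are separated, because the defining condition speaks
    only of the last; letters lie in \<open>G\<close> by assumption.\<close>
  proof (cases w rule: remdups_adj.cases)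
    case 1
    then have "factored [] \<and> concat [] = w" by (simp add: factored_def)
    then show ?thesis by blast
  next
    case (2 x)
    then show ?thesis using False assms letter_in_G by auto
  next
    case (3 x y xs)
    then show ?thesis using not_in_G_iff[OF assms] False by auto
  qed
qed

lemma factored_append:
  "factored (xs @ ys) \<longleftrightarrow> factored xs \<and> factored ys \<and> (\<forall>x\<in>set xs. \<forall>y\<in>set ys. prec\<^sup>=\<^sup>= x y)"
  by (auto simp: factored_def sorted_wrt_append)

lemma factored_Cons: "factored (x # xs) \<longleftrightarrow> x \<in> G \<and> factored xs \<and> (\<forall>y\<in>set xs. prec\<^sup>=\<^sup>= x y)"
  by (auto simp: factored_def)

lemma factored_le_last:
  assumes "factored ws" "x \<in> set ws"
  shows "prec\<^sup>=\<^sup>= x (last ws)"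
  using assms by (cases ws rule: rev_cases) (auto simp: factored_append)

section \<open>Suffixes in \<open>G\<close> and uniqueness of factorizations\<close>

definition suffix_less :: "'a list \<Rightarrow> bool" where
  "suffix_less w \<longleftrightarrow> (\<forall>p s. w = p @ s \<longrightarrow> p \<noteq> [] \<longrightarrow> s \<in> G \<longrightarrow> prec s w)"

text \<open>The last factor of \<open>y\<close> is a proper suffix of \<open>r\<close> lying in
  \<open>G\<close>, hence below \<open>r\<close>, and it is the largest factor of
  \<open>y\<close>.\<close>

lemma suffix_factored_less:
  assumes "r \<in> G" "suffix_less r" "r = x @ y" "y \<noteq> []" "x \<noteq> []"
  obtains ys where "factored ys" "concat ys = y" "ys \<noteq> []" "\<And>z. z \<in> set ys \<Longrightarrow> prec z r"
proof -
  have "y \<in> lists A" using G_lists[OF assms(1)] assms(3) by simp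
  then obtain ys where ys: "factored ys" "concat ys = y" using factored_exists by blast
  with assms(4) have ne: "ys \<noteq> []" by auto
  then have dec: "ys = butlast ys @ [last ys]" by simp
  have lastG: "last ys \<in> G" using ys ne by (auto simp: factored_def)
  have "y = concat (butlast ys) @ last ys"
    using ys(2) dec by (metis append.right_neutral concat.simps concat_append)
  then have "r = (x @ concat (butlast ys)) @ last ys" using assms(3) by simp
  then have last_less: "prec (last ys) r"
    using assms(2,5) lastG unfolding suffix_less_def by blast
  have "prec z r" if "z \<in> set ys" for z
    using factored_le_last[OF ys(1) that] last_less lastG prec_trans[of z "last ys" r] assms(1) that ys(1)
    by (auto simp: factored_def)
  with that ys ne show thesis by blast
qed

text \<open>Were \<open>s\<close> longer than the last factor, it would consist of an end
  \<open>y\<close> of some factor \<open>r\<close> and the later factors \<open>bs\<close>. The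
  factors of \<open>y\<close> are at most \<open>r\<close>, so together with \<open>bs\<close> they
  would factorize \<open>s\<close> into at least two factors. \<open>suffix_less\<close> is assumed
  of the factors only, so that the lemma can serve inside the induction that proves it for all of
  \<open>G\<close>.\<close>

lemma G_suffix_le_last:
  assumes "factored rs" "\<And>r. r \<in> set rs \<Longrightarrow> suffix_less r" "concat rs = p @ s" "s \<in> G"
  shows "length s \<le> length (last rs)"
proof -
  obtain as r bs x y where d: "rs = as @ r # bs" "p = concat as @ x" "r = x @ y" "y \<noteq> []"
    "s = y @ concat bs"
    using concat_eq_append_split[OF assms(3)] assms(4) G_nonempty by metis
  show ?thesis
  proof (cases "bs = []")
    case True
    then show ?thesis using d by simp
  next
    case False
    have f: "r \<in> G" "factored bs" "\<forall>b\<in>set bs. prec\<^sup>=\<^sup>= r b"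
      using assms(1) d(1) by (auto simp: factored_append factored_Cons)
    have sl: "suffix_less r" using assms(2) d(1) by simp
    obtain ys where ys: "factored ys" "concat ys = y" "ys \<noteq> []" "\<And>z. z \<in> set ys \<Longrightarrow> prec\<^sup>=\<^sup>= z r"
    proof (cases "x = []")
      case True
      then show thesis using that[of "[r]"] d f by (simp add: factored_def)
    next
      case False
      obtain ys where "factored ys" "concat ys = y" "ys \<noteq> []" "\<And>z. z \<in> set ys \<Longrightarrow> prec z r"
        using suffix_factored_less[OF f(1) sl d(3,4) False] by blast
      then show thesis using that[of ys] by simp
    qed
    have "prec\<^sup>=\<^sup>= z b" if "z \<in> set ys" "b \<in> set bs" for z b
      using ys(4)[OF that(1)] f(3) that prec_trans[of z r b] f ys(1) by (auto simp: factored_def)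
    then have "factored (ys @ bs)" using ys f by (simp add: factored_append)
    moreover have "concat (ys @ bs) = s" using ys d by simp
    ultimately have "ys @ bs = [s]" using factored_concat_in_G assms(4) by blast
    with ys(3) False show ?thesis by (cases ys) auto
  qed
qed

text \<open>Induction on length. For the longest proper suffix \<open>s\<close> in \<open>G\<close>,
  the rest \<open>p\<close> of \<open>w\<close> turns out to lie in \<open>G\<close> and above
  \<open>s\<close>, while \<open>p\<close> is below \<open>w\<close> by the third condition on
  \<open>G\<close>. Shorter suffixes are then compared with \<open>s\<close>.\<close>

lemma suffix_less_G: "w \<in> G \<Longrightarrow> suffix_less w"
proof (induction "length w" arbitrary: w rule: less_induct)
  case less
  show ?case unfolding suffix_less_def
  proof (intro allI impI)
    fix p0 s0 assume w0: "w = p0 @ s0" "p0 \<noteq> []" "s0 \<in> G"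
    define S where "S = (\<lambda>s. s \<in> G \<and> (\<exists>p. w = p @ s \<and> p \<noteq> []))"
    have "S s0" using w0 by (auto simp: S_def)
    moreover have "\<forall>s. S s \<longrightarrow> length s \<le> length w" by (auto simp: S_def)
    ultimately have "\<exists>s. S s \<and> (\<forall>t. S t \<longrightarrow> length t \<le> length s)"
      using ex_has_greatest_nat[of S s0 length "Suc (length w)"] by (simp add: less_Suc_eq_le)
    then obtain s where s: "S s" and longest: "\<And>t. S t \<Longrightarrow> length t \<le> length s" by auto
    obtain p where p: "w = p @ s" "p \<noteq> []" and sG: "s \<in> G" using s by (auto simp: S_def)
    have "p \<in> lists A" using G_lists[OF less.prems] p by simp
    then obtain ps where ps: "factored ps" "concat ps = p" using factored_exists by blast
    then have "ps \<noteq> []" using p by auto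
    then obtain qs q where q: "ps = qs @ [q]" by (metis rev_exhaust)
    have qG: "q \<in> G" and q0: "q \<noteq> []" using ps q G_nonempty by (auto simp: factored_def)
    \<comment> \<open>Otherwise \<open>s\<close> could be appended to the factorization of
      \<open>p\<close>, giving one of \<open>w\<close> with at least two factors.\<close>
    have not_le: "\<not> prec\<^sup>=\<^sup>= q s"
    proof
      assume le: "prec\<^sup>=\<^sup>= q s"
      have "prec\<^sup>=\<^sup>= z s" if "z \<in> set ps" for z
        using factored_le_last[OF ps(1) that] le q prec_trans[of z q s] qG sG that ps(1)
        by (auto simp: factored_def)
      then have "factored (ps @ [s])" using ps sG by (simp add: factored_append) (simp add: factored_def)
      moreover have "concat (ps @ [s]) = w" using ps p by simp
      ultimately show False using factored_concat_in_G[of "ps @ [s]"] less.prems \<open>ps \<noteq> []\<close> by auto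
    qed
    have "qs = []"
    proof (rule ccontr)
      assume "qs \<noteq> []"
      then have cq: "concat qs \<noteq> []" using ps q G_nonempty by (cases qs) (auto simp: factored_def)
      have w: "w = concat qs @ (q @ s)" using p ps q by simp
      have "q @ s \<notin> G"
        using longest[of "q @ s"] w cq q0 unfolding S_def by auto
      moreover have "q @ s \<in> lists A" using qG sG G_lists by simp
      moreover have "length (q @ s) \<ge> 2"
        using q0 sG G_nonempty by (cases q; cases s) auto
      ultimately obtain rs where rs: "factored rs" "concat rs = q @ s" "length rs \<ge> 2"
        using not_in_G_iff by blast
      then obtain ts t where t: "rs = ts @ [t]" by (cases rs rule: rev_cases) auto
      have "length r < length w" if "r \<in> set rs" for r
      proof -
        have "length r \<le> length (concat rs)" using split_list[OF that] by auto
        moreover have "length w = length (concat qs) + length (concat rs)" using w rs(2) by simp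
        moreover have "length (concat qs) > 0" using cq by blast
        ultimately show ?thesis by linarith
      qed
      then have "\<And>r. r \<in> set rs \<Longrightarrow> suffix_less r" using less.hyps rs(1) by (auto simp: factored_def)
      \<comment> \<open>As last factor of a word ending in \<open>s\<close>, the word
        \<open>t\<close> is at least as long as \<open>s\<close>; by the choice of \<open>s\<close>
        it is not longer. So \<open>t = s\<close>, and the factors before it multiply to
        \<open>q\<close> and reduce to \<open>q\<close> itself, which puts \<open>q\<close> before
        \<open>s\<close> in a factorization.\<close>
      then have 1: "length s \<le> length t" using G_suffix_le_last[OF rs(1) _ rs(2) sG] t by simp
      have "w = (concat qs @ concat ts) @ t" using w rs(2) t by simp
      moreover have tG: "t \<in> G" using rs t by (auto simp: factored_def)
      ultimately have "length t \<le> length s" using longest[of t] cq unfolding S_def by blast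
      with 1 have "concat ts = q" "t = s" using rs(2) t by auto
      moreover have "factored ts" using rs(1) t by (simp add: factored_append)
      ultimately have "ts = [q]" using factored_concat_in_G qG by blast
      then have "prec\<^sup>=\<^sup>= q s" using rs(1) t \<open>t = s\<close> by (simp add: factored_def)
      with not_le show False by blast
    qed
    then have "p = q" using ps q by simp
    then have "prec q w" using prec_append[OF qG sG] p less.prems by simp
    then have sw: "prec s w" using not_le prec_total[OF qG sG] prec_trans[of s q w] qG sG less.prems by auto
    \<comment> \<open>By its length \<open>s0\<close> is a suffix of \<open>s\<close>, so the
      induction hypothesis for \<open>s\<close> applies.\<close>
    have le: "length s0 \<le> length s" using longest \<open>S s0\<close> by blast
    have "s0 = s \<or> prec s0 s"
    proof (cases "s0 = s")
      case False
      have "p @ s = p0 @ s0" using w0(1) p(1) by simp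
      then obtain t where t: "s = t @ s0"
        by (rule append_eq_append_cases) (use le in auto)
      with False have "t \<noteq> []" by auto
      moreover have "suffix_less s" using less.hyps[of s] p sG by simp
      ultimately show ?thesis using t w0(3) unfolding suffix_less_def by blast
    qed simp
    then show "prec s0 w" using sw prec_trans[of s0 s w] w0(3) sG less.prems by blast
  qed
qed

text \<open>Each of the two last factors is a suffix in \<open>G\<close> of the same word, so each
  is at most as long as the other. They agree and can be removed.\<close>

lemma factored_unique:
  assumes "factored ws" "factored vs" "concat ws = concat vs"
  shows "ws = vs"
  using assms
proof (induction ws arbitrary: vs rule: rev_induct)
  case Nil
  then show ?case by (cases vs) (auto simp: factored_def)
next
  case (snoc w ws)
  have wG: "w \<in> G" "factored ws" using snoc.prems(1) by (simp_all add: factored_append factored_Cons)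
  then have "vs \<noteq> []" using snoc.prems(3) by auto
  then obtain us v where v: "vs = us @ [v]" by (metis rev_exhaust)
  have vG: "v \<in> G" "factored us" using snoc.prems(2) v by (simp_all add: factored_append factored_Cons)
  have eq: "concat ws @ w = concat us @ v" using snoc.prems v by simp
  have sl: "suffix_less r" if "factored rs" "r \<in> set rs" for r rs
    using suffix_less_G that by (auto simp: factored_def)
  have "length v \<le> length w"
    using G_suffix_le_last[OF snoc.prems(1) sl[OF snoc.prems(1)], of "concat us" v] eq vG by simp
  moreover have "length w \<le> length v"
    using G_suffix_le_last[OF snoc.prems(2) sl[OF snoc.prems(2)], of "concat ws" w] eq wG v by simp
  ultimately have "w = v" "concat ws = concat us" using eq by auto
  then show ?case using snoc.IH wG vG v by blast
qed

section \<open>Up-sets and the submonoids they determine\<close>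

definition upset :: "'a list set \<Rightarrow> bool" where
  "upset U \<longleftrightarrow> U \<subseteq> G \<and> (\<forall>x\<in>U. \<forall>y\<in>G. prec x y \<longrightarrow> y \<in> U)"

text \<open>By uniqueness of factorizations, asking for some factorization with factors in
  \<open>U\<close> is the same as asking it of the only one; \<open>factors_inD\<close> records
  this.\<close>

definition factors_in :: "'a list set \<Rightarrow> 'a list set" where
  "factors_in U = {concat ws | ws. factored ws \<and> set ws \<subseteq> U}"

lemma factors_inI: "factored ws \<Longrightarrow> set ws \<subseteq> U \<Longrightarrow> concat ws \<in> factors_in U"
  by (auto simp: factors_in_def)

lemma factors_inD:
  assumes "w \<in> factors_in U" "factored ws" "concat ws = w"
  shows "set ws \<subseteq> U"
proof -
  obtain vs where "w = concat vs" "factored vs" "set vs \<subseteq> U"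
    using assms(1) by (auto simp: factors_in_def)
  then show ?thesis using factored_unique[of ws vs] assms by simp
qed

lemma factors_in_lists: "w \<in> factors_in U \<Longrightarrow> w \<in> lists A"
  using factored_concat_lists by (auto simp: factors_in_def)

lemma factors_in_mono: "U \<subseteq> V \<Longrightarrow> factors_in U \<subseteq> factors_in V"
  by (auto simp: factors_in_def)

lemma upset_less:
  assumes "upset U" "x \<in> U" "y \<in> G" "y \<notin> U"
  shows "prec y x"
  using assms prec_total[of x y] unfolding upset_def by blast

lemma upset_atLeast: "m \<in> G \<Longrightarrow> upset {x \<in> G. prec\<^sup>=\<^sup>= m x}"
  unfolding upset_def by (auto intro: prec_trans)

lemma upset_greaterThan: "m \<in> G \<Longrightarrow> upset {x \<in> G. prec m x}"
  unfolding upset_def by (auto intro: prec_trans)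

text \<open>The first factor is the smallest, so it alone decides membership for an up-set.\<close>

lemma factors_in_hd:
  assumes "upset U" "factored (r # rs)" "r \<in> U"
  shows "concat (r # rs) \<in> factors_in U"
proof (rule factors_inI[OF assms(2)])
  have "x \<in> U" if "x \<in> set rs" for x
  proof -
    have "x \<in> G" "prec\<^sup>=\<^sup>= r x" using assms(2) that by (auto simp: factored_def)
    then show ?thesis using assms(1,3) by (auto simp: upset_def)
  qed
  then show "set (r # rs) \<subseteq> U" using assms(3) by auto
qed

text \<open>The factors of \<open>u\<close> outside \<open>U\<close> come first. Multiplying the
  others by \<open>v\<close> stays over \<open>U\<close>, so the outside ones remain factors of
  \<open>u @ v\<close>, and there can be none. The assumption \<open>closed\<close> is the part of
  closure under products that is available while that closure is being proved by induction.\<close>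

lemma factors_in_cancel_right:
  assumes U: "upset U" and v: "v \<in> factors_in U" and uv: "u @ v \<in> factors_in U"
    and closed: "\<And>b. b \<in> factors_in U \<Longrightarrow> length b \<le> length u \<Longrightarrow> b @ v \<in> factors_in U"
  shows "u \<in> factors_in U"
proof -
  have "u \<in> lists A" using factors_in_lists[OF uv] by simp
  then obtain us where us: "factored us" "concat us = u" using factored_exists by blast
  define as where "as = takeWhile (\<lambda>x. x \<notin> U) us"
  define bs where "bs = dropWhile (\<lambda>x. x \<notin> U) us"
  have ab: "us = as @ bs" by (simp add: as_def bs_def)
  have f: "factored as" "factored bs" using us(1) ab by (auto simp: factored_append)
  have asU: "x \<notin> U" if "x \<in> set as" for x
    using that unfolding as_def by (auto dest: set_takeWhileD)
  have b: "concat bs \<in> factors_in U"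
  proof (cases bs)
    case Nil
    then show ?thesis using factors_inI[of "[]"] by (simp add: factored_def)
  next
    case (Cons r rs)
    then have "r \<in> U" using bs_def by (metis dropWhile_eq_Cons_conv)
    then show ?thesis using factors_in_hd[OF U] Cons f(2) by blast
  qed
  have "length (concat bs) \<le> length u" using us ab by auto
  then have "concat bs @ v \<in> factors_in U" using closed b by blast
  then obtain cs where cs: "concat cs = concat bs @ v" "factored cs" "set cs \<subseteq> U"
    by (auto simp: factors_in_def)
  have "prec\<^sup>=\<^sup>= x y" if "x \<in> set as" "y \<in> set cs" for x y
    using upset_less[OF U, of y x] asU that f(1) cs(3) by (auto simp: factored_def)
  then have "factored (as @ cs)" using f cs by (simp add: factored_append)
  moreover have "concat (as @ cs) = u @ v" using cs us ab by auto
  ultimately have "set (as @ cs) \<subseteq> U" using factors_inD uv by blast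
  then have "as = []" using asU by (cases as) auto
  then show ?thesis using b ab us by simp
qed

text \<open>Induction on the length of \<open>u\<close>, over all up-sets at once. Suppose the first
  factor \<open>r\<close> of \<open>u @ v\<close> lies outside \<open>U\<close>. If \<open>r\<close>
  is a prefix of \<open>u\<close>, cancelling \<open>v\<close> shows that \<open>r\<close> is a
  factor of \<open>u\<close>. Otherwise \<open>r\<close> reaches into \<open>v\<close>, and
  \<open>v\<close> has a factor below \<open>r\<close>. Either way \<open>r\<close> would lie in
  \<open>U\<close>.\<close>

lemma factors_in_append:
  assumes "upset U" "u \<in> factors_in U" "v \<in> factors_in U"
  shows "u @ v \<in> factors_in U"
  using assms
proof (induction "length u" arbitrary: u U rule: less_induct)
  case less
  note U = less.prems(1)
  show ?case
  proof (rule ccontr)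
    assume nin: "u @ v \<notin> factors_in U"
    have "u @ v \<in> lists A" using less.prems factors_in_lists by simp
    then obtain rs' where rs': "factored rs'" "concat rs' = u @ v" using factored_exists by blast
    have "rs' \<noteq> []" using rs' less.prems(3) nin by auto
    then obtain r rs where rs: "rs' = r # rs" by (cases rs') auto
    have rU: "r \<notin> U" using factors_in_hd[OF U] rs rs' nin by metis
    have rG: "r \<in> G" "factored rs" "\<forall>y\<in>set rs. prec\<^sup>=\<^sup>= r y" using rs' rs by (auto simp: factored_Cons)
    have "r @ concat rs = u @ v" using rs rs' by simp
    then consider u' where "u = r @ u'" "concat rs = u' @ v"
      | v' where "r = u @ v'" "v = v' @ concat rs" "v' \<noteq> []"
      by (rule append_eq_append_cases) auto
    then show False
    proof cases
      case 1
      \<comment> \<open>The argument passes to a larger up-set, for which the factors after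
        \<open>r\<close> are known to be inside; the induction hypothesis for it supplies the
        products needed to cancel \<open>v\<close>.\<close>
      let ?V = "{x \<in> G. prec\<^sup>=\<^sup>= r x}"
      have V: "upset ?V" using upset_atLeast rG(1) by blast
      have UV: "U \<subseteq> ?V" using upset_less[OF U _ rG(1) rU] U by (auto simp: upset_def)
      have v: "v \<in> factors_in ?V" using factors_in_mono[OF UV] less.prems by blast
      have "concat rs \<in> factors_in ?V"
        using rG by (intro factors_inI) (auto simp: factored_def)
      then have u'v: "u' @ v \<in> factors_in ?V" using 1 by simp
      have "u' \<in> factors_in ?V"
      proof (rule factors_in_cancel_right[OF V v u'v])
        fix b assume b: "b \<in> factors_in ?V" "length b \<le> length u'"
        have "r \<noteq> []" using rG(1) G_nonempty by blast
        then have "length b < length u" using b 1 by (cases r) auto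
        then show "b @ v \<in> factors_in ?V" using less.hyps V b v by blast
      qed
      then obtain us where us: "u' = concat us" "factored us" "set us \<subseteq> ?V"
        by (auto simp: factors_in_def)
      then have "factored (r # us)" using rG by (auto simp: factored_Cons)
      moreover have "concat (r # us) = u" using us 1 by simp
      ultimately have "set (r # us) \<subseteq> U" using factors_inD less.prems(2) by blast
      with rU show False by simp
    next
      case 2
      have "u \<noteq> []" using nin less.prems(3) by auto
      then obtain ys where ys: "factored ys" "concat ys = v'" "ys \<noteq> []" "\<And>z. z \<in> set ys \<Longrightarrow> prec z r"
        using suffix_factored_less[OF rG(1) suffix_less_G[OF rG(1)] 2(1,3)] by blast
      have "prec\<^sup>=\<^sup>= z y" if "z \<in> set ys" "y \<in> set rs" for z y
        using ys(4)[OF that(1)] rG that ys(1) prec_trans[of z r y] by (auto simp: factored_def)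
      then have "factored (ys @ rs)" using ys rG by (simp add: factored_append)
      moreover have "concat (ys @ rs) = v" using ys 2 by simp
      ultimately have "set (ys @ rs) \<subseteq> U" using factors_inD less.prems(3) by blast
      moreover obtain y where "y \<in> set ys" using ys(3) by (cases ys) auto
      ultimately have "y \<in> U" "prec y r" using ys(4) by auto
      then show False using U rG(1) rU by (auto simp: upset_def)
    qed
  qed
qed

section \<open>Products that cannot lie in \<open>G\<close>\<close>

lemma Cons_factors_in_notin_G:
  assumes "m \<in> G" "v \<in> factors_in {x \<in> G. prec\<^sup>=\<^sup>= m x}" "v \<noteq> []"
  shows "m @ v \<notin> G"
proof
  assume G: "m @ v \<in> G"
  obtain vs where vs: "v = concat vs" "factored vs" "set vs \<subseteq> {x \<in> G. prec\<^sup>=\<^sup>= m x}"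
    using assms(2) by (auto simp: factors_in_def)
  then have "factored (m # vs)" using assms(1) by (auto simp: factored_Cons)
  then have "m # vs = [m @ v]" using factored_concat_in_G[of "m # vs"] G vs by simp
  then show False using assms(3) by simp
qed

text \<open>Everything after the leading \<open>u\<close> is a product of elements at least
  \<open>u\<close>, so its factors may follow \<open>u\<close> in a factorization of length at least
  2.\<close>

lemma append_notin_G_if_hd_le:
  assumes "factored (u # us)" "factored (v # vs)" "prec\<^sup>=\<^sup>= u v"
  shows "concat (u # us) @ concat (v # vs) \<notin> G"
proof -
  let ?U = "{x \<in> G. prec\<^sup>=\<^sup>= u x}"
  have G: "u \<in> G" "v \<in> G" using assms by (auto simp: factored_Cons)
  have "concat us \<in> factors_in ?U"
    using assms(1) by (intro factors_inI) (auto simp: factored_def)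
  moreover have "concat (v # vs) \<in> factors_in ?U"
    using factors_in_hd[OF upset_atLeast[OF G(1)] assms(2)] assms(3) G by blast
  ultimately have "concat us @ concat (v # vs) \<in> factors_in ?U"
    using factors_in_append[OF upset_atLeast[OF G(1)]] by blast
  moreover have "v \<noteq> []" using G G_nonempty by blast
  ultimately show ?thesis using Cons_factors_in_notin_G[OF G(1)] by simp
qed

text \<open>Of the two products, the one starting with the smaller first factor is outside
  \<open>G\<close>.\<close>

lemma append_commute_notin_G:
  assumes "u @ v \<in> G" "v @ u \<in> G"
  shows "u = [] \<or> v = []"
proof (rule ccontr)
  assume ne: "\<not> (u = [] \<or> v = [])"
  have "u \<in> lists A" "v \<in> lists A" using G_lists[OF assms(1)] by auto
  then obtain us vs where f: "factored us" "concat us = u" "factored vs" "concat vs = v"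
    using factored_exists by metis
  with ne obtain x xs y ys where c: "us = x # xs" "vs = y # ys" by (cases us; cases vs) auto
  with f have "x \<in> G" "y \<in> G" by (auto simp: factored_def)
  then have "prec\<^sup>=\<^sup>= x y \<or> prec\<^sup>=\<^sup>= y x" using prec_total by auto
  then show False using append_notin_G_if_hd_le f c assms by metis
qed

section \<open>Existence of a conjugate in \<open>G\<close>\<close>

lemma factors_greater_append:
  assumes m: "m \<in> G" and f: "f \<in> factors_in {x \<in> G. prec m x}" "f \<noteq> []"
  shows "f @ m \<in> factors_in {x \<in> G. prec m x}"
proof (rule ccontr)
  let ?U = "{x \<in> G. prec m x}" and ?V = "{x \<in> G. prec\<^sup>=\<^sup>= m x}"
  assume nin: "f @ m \<notin> factors_in ?U"
  have V: "upset ?V" using upset_atLeast[OF m] .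
  have mV: "m \<in> factors_in ?V" using factors_inI[of "[m]" ?V] m by (simp add: factored_def)
  have fV: "f \<in> factors_in ?V" using f factors_in_mono[of ?U ?V] by auto
  have fm: "f @ m \<in> factors_in ?V" using factors_in_append[OF V fV mV] .
  then obtain rs' where rs': "f @ m = concat rs'" "factored rs'" "set rs' \<subseteq> ?V"
    by (auto simp: factors_in_def)
  with f obtain r rs where rs: "rs' = r # rs" by (cases rs') auto
  \<comment> \<open>All factors of \<open>f @ m\<close> are at least \<open>m\<close>. If the first
    were above \<open>m\<close>, all would be; hence it equals \<open>m\<close>.\<close>
  have "r \<notin> ?U" using factors_in_hd[OF upset_greaterThan[OF m]] rs rs' nin by metis
  then have "r = m" using rs' rs by auto
  have frs: "factored rs" "\<forall>y\<in>set rs. prec\<^sup>=\<^sup>= m y" using rs' rs \<open>r = m\<close> by (auto simp: factored_Cons)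
  have eq: "m @ concat rs = f @ m" using rs' rs \<open>r = m\<close> by simp
  then consider f' where "f = m @ f'" "concat rs = f' @ m"
    | y where "m = f @ y" "m = y @ concat rs" "y \<noteq> []"
    by (rule append_eq_append_cases)
  then show False
  proof cases
    case 1
    have "f' @ m \<in> factors_in ?V" using 1 factors_inI[OF frs(1), of ?V] rs' rs by simp
    \<comment> \<open>Cancelling the final \<open>m\<close> makes \<open>m\<close> the first factor
      of \<open>f\<close>, although the factors of \<open>f\<close> are strictly above
      \<open>m\<close>.\<close>
    then have "f' \<in> factors_in ?V"
      using factors_in_cancel_right[OF V mV] factors_in_append[OF V _ mV] by blast
    then obtain fs where fs: "f' = concat fs" "factored fs" "set fs \<subseteq> ?V"
      by (auto simp: factors_in_def)
    then have "factored (m # fs)" using m by (auto simp: factored_Cons)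
    moreover have "concat (m # fs) = f" using fs 1 by simp
    ultimately have "set (m # fs) \<subseteq> ?U" using factors_inD f(1) by blast
    then show False using prec_irrefl m by simp
  next
    case 2
    \<comment> \<open>Here \<open>m\<close> ends in \<open>y\<close> followed by \<open>rs\<close>.
      The factors of \<open>y\<close> are below \<open>m\<close> and so fit before
      \<open>rs\<close>; as \<open>m\<close> has only the trivial factorization, \<open>rs\<close>
      is empty and \<open>f\<close> would be empty.\<close>
    obtain ys where ys: "factored ys" "concat ys = y" "ys \<noteq> []" "\<And>z. z \<in> set ys \<Longrightarrow> prec z m"
      using suffix_factored_less[OF m suffix_less_G[OF m] 2(1,3) f(2)] by blast
    have "prec\<^sup>=\<^sup>= z x" if "z \<in> set ys" "x \<in> set rs" for z x
      using ys(4)[OF that(1)] frs that ys(1) prec_trans[of z m x] m by (auto simp: factored_def)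
    then have "factored (ys @ rs)" using ys frs by (simp add: factored_append)
    moreover have "concat (ys @ rs) = m" using ys 2 by simp
    ultimately have "ys @ rs = [m]" using factored_concat_in_G m by blast
    then have "rs = []" using ys(3) by (cases ys) auto
    then show False using eq f(2) by simp
  qed
qed

text \<open>Appending \<open>m\<close> leaves the word nonempty with all factors above
  \<open>m\<close>, so the step can be iterated.\<close>

lemma factors_greater_append_power:
  assumes "m \<in> G" "f \<in> factors_in {x \<in> G. prec m x}" "f \<noteq> []"
  shows "f @ concat (replicate j m) \<in> factors_in {x \<in> G. prec m x}"
  using assms(2,3)
proof (induction j arbitrary: f)
  case (Suc j)
  show ?case using Suc.IH[OF factors_greater_append[OF assms(1) Suc.prems]] Suc.prems by simp
qed simp

lemma exists_conjugate_in_G: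
  assumes w: "w \<in> lists A" "w \<noteq> []" and prim: "primitive_word w"
  shows "\<exists>x. conjugate_of x w \<and> x \<in> G"
proof -
  define S where "S = {m. \<exists>ms. factored (m # ms) \<and> conjugate_of (concat (m # ms)) w}"
  have SG: "S \<subseteq> G" by (auto simp: S_def factored_def)
  \<comment> \<open>First factors of conjugates use only letters of \<open>w\<close> and are no
    longer than \<open>w\<close>. This makes \<open>S\<close> finite, so it has a maximal
    element.\<close>
  have "S \<subseteq> {m. set m \<subseteq> set w \<and> length m \<le> length w}"
  proof
    fix m assume "m \<in> S"
    then obtain ms n where "m @ concat ms = rotate n w"
      by (auto simp: S_def conjugate_of_iff_rotate)
    then have "set (m @ concat ms) = set w" "length (m @ concat ms) = length w" by simp_all
    then show "m \<in> {m. set m \<subseteq> set w \<and> length m \<le> length w}"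
      unfolding set_append length_append by auto
  qed
  then have fin: "finite S" using finite_lists_length_le[of "set w" "length w"] finite_subset by blast
  obtain ws where "factored ws" "concat ws = w" using factored_exists w by blast
  with w have "S \<noteq> {}" using conjugate_of_refl[of w] by (cases ws) (auto simp: S_def)
  have trans: "transp_on S prec" using prec_trans SG unfolding transp_on_def by blast
  have "asymp_on S prec" unfolding asymp_on_def
  proof (intro ballI impI notI)
    fix x y assume xy: "x \<in> S" "y \<in> S" "prec x y" "prec y x"
    then have "x \<in> G" "y \<in> G" using SG by auto
    then show False using prec_trans[of x y x] prec_irrefl[of x] xy by blast
  qed
  then have "\<exists>m\<in>S. \<forall>x\<in>S. x \<noteq> m \<longrightarrow> \<not> prec m x"
    using Finite_Set.bex_max_element[OF fin _ trans \<open>S \<noteq> {}\<close>] by blast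
  then obtain m where mS: "m \<in> S" and max': "\<forall>x\<in>S. x \<noteq> m \<longrightarrow> \<not> prec m x" by blast
  obtain ms where ms: "factored (m # ms)" "conjugate_of (concat (m # ms)) w"
    using mS by (auto simp: S_def)
  have mG: "m \<in> G" using mS SG by blast
  have max: "\<not> prec m x" if "x \<in> S" for x
    using max' prec_irrefl[OF mG] that by (cases "x = m") auto
  define j where "j = length (takeWhile (\<lambda>x. x = m) (m # ms))"
  define fs where "fs = dropWhile (\<lambda>x. x = m) (m # ms)"
  have tw: "takeWhile (\<lambda>x. x = m) (m # ms) = replicate j m"
    unfolding j_def by (rule replicate_length_same[symmetric]) (auto dest: set_takeWhileD)
  have dec: "m # ms = replicate j m @ fs"
    unfolding fs_def tw[symmetric] by (rule takeWhile_dropWhile_id[symmetric])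
  have ffs: "factored fs" using ms(1) dec by (simp add: factored_append)
  have j: "j \<ge> 1" by (simp add: j_def)
  show ?thesis
  proof (cases fs)
    case Nil
    have prim': "primitive_word (concat (m # ms))"
      using primitive_word_conjugate[OF prim ms(2)] .
    have "concat (m # ms) = concat (replicate j m)" using dec Nil by simp
    with prim' have "\<not> j \<ge> 2" unfolding primitive_word_def by metis
    with j have "j = 1" by simp
    with dec Nil have "concat (m # ms) = m" by simp
    then show ?thesis using ms(2) mG by metis
  next
    case (Cons r rs)
    let ?U = "{x \<in> G. prec m x}" and ?f = "concat fs"
    \<comment> \<open>The first factor after the copies of \<open>m\<close> is at least
      \<open>m\<close> and different from it, hence above it, and so are all later ones.\<close>
    have "r \<noteq> m" using hd_dropWhile[of "\<lambda>x. x = m" "m # ms", folded fs_def] Cons by simp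
    moreover have "r \<in> set (m # ms)" using dec Cons by simp
    ultimately have rU: "r \<in> ?U" using ms(1) by (auto simp: factored_def)
    then have "?f \<in> factors_in ?U"
      using factors_in_hd[OF upset_greaterThan[OF mG]] ffs Cons by blast
    moreover have f0: "?f \<noteq> []" using Cons rU G_nonempty by auto
    ultimately have "?f @ concat (replicate j m) \<in> factors_in ?U"
      using factors_greater_append_power[OF mG] by blast
    then obtain hs where hs: "?f @ concat (replicate j m) = concat hs" "factored hs" "set hs \<subseteq> ?U"
      by (auto simp: factors_in_def)
    then obtain h hs' where h: "hs = h # hs'" using f0 by (cases hs) auto
    \<comment> \<open>Rotating the copies of \<open>m\<close> to the end gives a conjugate of
      \<open>w\<close> whose first factor \<open>h\<close> is above \<open>m\<close>, against
      maximality.\<close>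
    have "concat (m # ms) = concat (replicate j m) @ ?f" using dec by (metis concat_append)
    then have "conjugate_of (concat hs) (concat (m # ms))"
      using hs(1) unfolding conjugate_of_def by metis
    then have "conjugate_of (concat hs) w" using ms(2) conjugate_of_trans by blast
    then have "h \<in> S" using hs(2) h by (auto simp: S_def)
    then show ?thesis using max hs(3) h by auto
  qed
qed

section \<open>Uniqueness of the conjugate and exclusion of powers\<close>

lemma conjugates_in_G_eq:
  assumes "x \<in> G" "y \<in> G" "conjugate_of x y"
  shows "x = y"
proof -
  obtain u v where uv: "y = u @ v" "x = v @ u" using assms(3) by (auto simp: conjugate_of_def)
  then have "u = [] \<or> v = []" using append_commute_notin_G assms by blast
  with uv show ?thesis by auto
qed

text \<open>A proper power of \<open>u\<close> splits off one \<open>u\<close> on either side, so it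
  is the product of the same two words in both orders.\<close>

lemma not_primitive_notin_G:
  assumes "w \<noteq> []" "\<not> primitive_word w"
  shows "w \<notin> G"
proof
  assume G: "w \<in> G"
  obtain u k where k: "k \<ge> 2" and w: "w = concat (replicate k u)"
    using assms(2) by (auto simp: primitive_word_def)
  obtain n where n: "k = Suc (Suc n)" using k by (metis add_2_eq_Suc le_Suc_ex)
  let ?v = "concat (replicate (Suc n) u)"
  have 1: "w = u @ ?v" using w n by simp
  have "w = concat (replicate (Suc n) u @ [u])" using w n by (simp add: replicate_append_same)
  then have 2: "w = ?v @ u" by simp
  have "u = [] \<or> ?v = []" using append_commute_notin_G G 1 2 by metis
  then have "u = []" by auto
  then have "w = []" using w by simp
  with assms(1) show False by blast
qed

end

theorem theorem3p7:
  fixes A :: "'a set" and G :: "'a list set" and prec :: "'a list \<Rightarrow> 'a list \<Rightarrow> bool"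
  assumes "finite A" and "card A \<ge> 2"
    and "nyldon_like A G prec"
  shows "(\<forall>w\<in>lists A - {[]}. primitive_word w \<longrightarrow> (\<exists>!x. conjugate_of x w \<and> x \<in> G))
       \<and> (\<forall>w\<in>lists A - {[]}. \<not> primitive_word w \<longrightarrow> w \<notin> G)"
proof -
  interpret nyldon A G prec using assms(3) by unfold_locales
  have "\<exists>!x. conjugate_of x w \<and> x \<in> G" if "w \<in> lists A - {[]}" "primitive_word w" for w
  proof (rule ex_ex1I)
    show "\<exists>x. conjugate_of x w \<and> x \<in> G" using exists_conjugate_in_G that by blast
  next
    fix x y assume "conjugate_of x w \<and> x \<in> G" "conjugate_of y w \<and> y \<in> G"
    then show "x = y"
      using conjugates_in_G_eq conjugate_of_trans[OF _ conjugate_of_sym] by blast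
  qed
  then show ?thesis using not_primitive_notin_G by blast
qed

end
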